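(* Let $G=(V,E)$ be a strongly connected graph and let $\pi=(\pi_1,\ldots,\pi_p)$ be an equitable partition of $G$, with quotient graph $G/\pi$. Let $Q=Q(G)$ and $\widehat{Q}=Q(G/\pi)$, and let $P$ be the $V\times\{1,\ldots,p\}$ matrix with $P_{vi}=1$ if $v\in\pi_i$ and $P_{vi}=0$ otherwise. Then the map $$\rho:\mathcal{K}^{*}(G/\pi)\to\mathcal{K}^{*}(G),\qquad \rho(\mathbf{x}+\widehat{Q}\mathbf{Z}^{p}):=P\mathbf{x}+Q\mathbf{Z}^{V},$$ is a well-defined injective group homomorphism.
   Context: A graph is a finite directed multigraph (loops and multiple edges allowed); an undirected edge is regarded as a pair of oppositely oriented directed edges. For a graph $G=(V,E)$, $A(G)$ is the $V\times V$ matrix whose $(v,w)$-entry is the number of directed edges with initial vertex $v$ and terminal vertex $w$; $\Delta(G)$ is the diagonal matrix with $\Delta_{vv}=\sum_{w}A_{vw}$ (outdegree of $v$); the Laplacian is $Q(G)=\Delta(G)-A(G)$. The dual critical group is $\mathcal{K}^{*}(G):=\mathbf{Z}^{V}/Q(G)\mathbf{Z}^{V}$. An ordered partition $\pi=(\pi_1,\ldots,\pi_p)$ of $V$ into nonempty blocks is equitable if there exist nonnegative integers $F_{ij},R_{ij}$ ($1\le i,j\le p$) such that every vertex of $\pi_i$ is the initial vertex of exactly $F_{ij}$ directed edges with terminal vertex in $\pi_j$, and every vertex of $\pi_j$ is the terminal vertex of exactly $R_{ij}$ directed edges with initial vertex in $\pi_i$. The quotient $G/\pi$ is the graph on vertex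 set $\{1,\ldots,p\}$ with adjacency matrix $F=(F_{ij})$. *)

theory Defs
  imports
    "Graph_Theory.Digraph"
    "Graph_Theory.Digraph_Component"
    "HOL-Algebra.Coset"
    "HOL-Algebra.Elementary_Groups"
    "HOL-Algebra.Product_Groups"
begin

text \<open>
  An $I \times J$ integer matrix is a function \<open>'i \<Rightarrow> 'j \<Rightarrow> int\<close>, of which only the entries with
  indices in \<open>I\<close> and \<open>J\<close> matter.  Elements of \<open>\<int>\<^sup>I\<close> are functions that are \<open>undefined\<close> outside
  \<open>I\<close>, as required by \<^const>\<open>product_group\<close>.
\<close>

definition int_vectors :: "'i set \<Rightarrow> ('i \<Rightarrow> int) monoid" where
  "int_vectors I = product_group I (\<lambda>_. integer_group)"

definition mat_vec :: "'i set \<Rightarrow> 'j set \<Rightarrow> ('i \<Rightarrow> 'j \<Rightarrow> int) \<Rightarrow> ('j \<Rightarrow> int) \<Rightarrow> ('i \<Rightarrow> int)" where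
  "mat_vec I J M x = (\<lambda>i\<in>I. \<Sum>j\<in>J. M i j * x j)"

definition adjacency_matrix :: "('a, 'b) pre_digraph \<Rightarrow> 'a \<Rightarrow> 'a \<Rightarrow> int" where
  "adjacency_matrix G v w = int (card {e \<in> arcs G. tail G e = v \<and> head G e = w})"

definition degree_matrix :: "('a, 'b) pre_digraph \<Rightarrow> 'a \<Rightarrow> 'a \<Rightarrow> int" where
  "degree_matrix G v w = (if v = w then (\<Sum>u\<in>verts G. adjacency_matrix G v u) else 0)"

definition laplacian :: "('a, 'b) pre_digraph \<Rightarrow> 'a \<Rightarrow> 'a \<Rightarrow> int" where
  "laplacian G v w = degree_matrix G v w - adjacency_matrix G v w"

definition laplacian_image :: "('a, 'b) pre_digraph \<Rightarrow> ('a \<Rightarrow> int) set" where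
  "laplacian_image G =
     mat_vec (verts G) (verts G) (laplacian G) ` carrier (int_vectors (verts G))"

definition dual_critical_group :: "('a, 'b) pre_digraph \<Rightarrow> ('a \<Rightarrow> int) set monoid" where
  "dual_critical_group G = int_vectors (verts G) Mod laplacian_image G"

definition ordered_partition :: "'a set \<Rightarrow> nat \<Rightarrow> (nat \<Rightarrow> 'a set) \<Rightarrow> bool" where
  "ordered_partition V p \<pi> \<longleftrightarrow>
     (\<forall>i\<in>{1..p}. \<pi> i \<noteq> {}) \<and> disjoint_family_on \<pi> {1..p} \<and> (\<Union>i\<in>{1..p}. \<pi> i) = V"

definition equitable_with ::
  "('a, 'b) pre_digraph \<Rightarrow> nat \<Rightarrow> (nat \<Rightarrow> 'a set) \<Rightarrow> (nat \<Rightarrow> nat \<Rightarrow> nat) \<Rightarrow> (nat \<Rightarrow> nat \<Rightarrow> nat) \<Rightarrow> bool"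
where
  "equitable_with G p \<pi> F R \<longleftrightarrow>
     (\<forall>i\<in>{1..p}. \<forall>j\<in>{1..p}.
        (\<forall>v\<in>\<pi> i. card {e \<in> arcs G. tail G e = v \<and> head G e \<in> \<pi> j} = F i j) \<and>
        (\<forall>w\<in>\<pi> j. card {e \<in> arcs G. head G e = w \<and> tail G e \<in> \<pi> i} = R i j))"

definition equitable_partition :: "('a, 'b) pre_digraph \<Rightarrow> nat \<Rightarrow> (nat \<Rightarrow> 'a set) \<Rightarrow> bool" where
  "equitable_partition G p \<pi> \<longleftrightarrow>
     ordered_partition (verts G) p \<pi> \<and> (\<exists>F R. equitable_with G p \<pi> F R)"

text \<open>
  Since the blocks are nonempty, the entries $F_{ij}$ with $1 \le i, j \le p$ are uniquely
  determined; the choice below only affects irrelevant indices.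
\<close>

definition quotient_matrix :: "('a, 'b) pre_digraph \<Rightarrow> nat \<Rightarrow> (nat \<Rightarrow> 'a set) \<Rightarrow> nat \<Rightarrow> nat \<Rightarrow> nat" where
  "quotient_matrix G p \<pi> = (SOME F. \<exists>R. equitable_with G p \<pi> F R)"

text \<open>The arc \<open>(i, j, k)\<close> is the \<open>k\<close>-th of the $F_{ij}$ parallel arcs from \<open>i\<close> to \<open>j\<close>.\<close>

definition quotient_graph ::
  "('a, 'b) pre_digraph \<Rightarrow> nat \<Rightarrow> (nat \<Rightarrow> 'a set) \<Rightarrow> (nat, nat \<times> nat \<times> nat) pre_digraph" where
  "quotient_graph G p \<pi> =
     \<lparr>verts = {1..p},
      arcs = {(i, j, k). i \<in> {1..p} \<and> j \<in> {1..p} \<and> k < quotient_matrix G p \<pi> i j},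
      tail = (\<lambda>(i, j, k). i),
      head = (\<lambda>(i, j, k). j)\<rparr>"

definition partition_matrix :: "(nat \<Rightarrow> 'a set) \<Rightarrow> 'a \<Rightarrow> nat \<Rightarrow> int" where
  "partition_matrix \<pi> v i = (if v \<in> \<pi> i then 1 else 0)"

lemma equitable_with_quotient_matrix:
  assumes "equitable_partition G p \<pi>"
  shows "\<exists>R. equitable_with G p \<pi> (quotient_matrix G p \<pi>) R"
  using assms unfolding equitable_partition_def quotient_matrix_def
  by (intro someI_ex[where P = "\<lambda>F. \<exists>R. equitable_with G p \<pi> F R"]) simp

lemma quotient_matrix_eq:
  assumes "equitable_partition G p \<pi>" "equitable_with G p \<pi> F R" "i \<in> {1..p}" "j \<in> {1..p}"
  shows "quotient_matrix G p \<pi> i j = F i j"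
proof -
  obtain v where v: "v \<in> \<pi> i"
    using assms unfolding equitable_partition_def ordered_partition_def by blast
  obtain R' where "equitable_with G p \<pi> (quotient_matrix G p \<pi>) R'"
    using equitable_with_quotient_matrix[OF assms(1)] by blast
  then have "card {e \<in> arcs G. tail G e = v \<and> head G e \<in> \<pi> j} = quotient_matrix G p \<pi> i j"
    using assms(3,4) v unfolding equitable_with_def by blast
  moreover have "card {e \<in> arcs G. tail G e = v \<and> head G e \<in> \<pi> j} = F i j"
    using assms(2-4) v unfolding equitable_with_def by blast
  ultimately show ?thesis by simp
qed

lemma adjacency_matrix_quotient_graph:
  assumes "i \<in> {1..p}" "j \<in> {1..p}"
  shows "adjacency_matrix (quotient_graph G p \<pi>) i j = int (quotient_matrix G p \<pi> i j)"
proof -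
  have "{e \<in> arcs (quotient_graph G p \<pi>).
          tail (quotient_graph G p \<pi>) e = i \<and> head (quotient_graph G p \<pi>) e = j}
        = (\<lambda>k. (i, j, k)) ` {..<quotient_matrix G p \<pi> i j}"
    using assms by (auto simp: quotient_graph_def)
  then show ?thesis
    by (simp add: adjacency_matrix_def card_image inj_on_def)
qed

lemma fin_digraph_quotient_graph: "fin_digraph (quotient_graph G p \<pi>)"
proof -
  have "{(i, j, k). i \<in> {1..p} \<and> j \<in> {1..p} \<and> k < quotient_matrix G p \<pi> i j}
        = (SIGMA i:{1..p}. SIGMA j:{1..p}. {..<quotient_matrix G p \<pi> i j})"
    by auto
  then have fin: "finite (arcs (quotient_graph G p \<pi>))"
    by (simp only: quotient_graph_def pre_digraph.simps)
      (intro finite_SigmaI finite_atLeastAtMost finite_lessThan)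
  show ?thesis
  proof
    show "finite (verts (quotient_graph G p \<pi>))"
      by (simp add: quotient_graph_def)
    show "finite (arcs (quotient_graph G p \<pi>))"
      by (rule fin)
  qed (auto simp only: quotient_graph_def pre_digraph.simps mem_Collect_eq split: prod.splits)
qed

end

theory Submission
  imports Defs Complex_Main
begin

text \<open>
  Equitability gives \<open>Q P = P Q'\<close>, with \<open>Q'\<close> the Laplacian of the quotient, so \<open>\<rho>\<close> is a
  well-defined homomorphism.  For injectivity suppose \<open>P x = Q z\<close> with \<open>z\<close> integral, and let the
  real vector \<open>y\<close> list the averages of \<open>z\<close> over the blocks.  Summing \<open>P x = Q z\<close> over a block and
  double counting the arcs between two blocks gives \<open>x = Q' y\<close>, so that \<open>Q (z - P y) = 0\<close>.  By the
  maximum principle on a strongly connected graph \<open>z - P y\<close> is constant.  Thus \<open>z\<close> is constant on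
  blocks, \<open>z = P z'\<close> with \<open>z'\<close> integral, and \<open>P x = Q P z' = P Q' z'\<close> yields \<open>x = Q' z'\<close>.
\<close>

section \<open>Injective homomorphisms between quotient groups\<close>

text \<open>First isomorphism theorem for the composite of \<open>f\<close> with the projection to
  \<open>B Mod M\<close>. In \<open>iff\<close>, the direction from right to left makes the induced
  map well defined, and the other direction makes it injective.\<close>

lemma induced_hom_on_quotients:
  assumes "group_hom A B f" "N \<lhd> A" "M \<lhd> B"
    and iff: "\<And>x. x \<in> carrier A \<Longrightarrow> f x \<in> M \<longleftrightarrow> x \<in> N"
  shows "\<exists>\<rho>. (\<forall>x\<in>carrier A. \<rho> (N #>\<^bsub>A\<^esub> x) = M #>\<^bsub>B\<^esub> f x) \<and>
    group_hom (A Mod N) (B Mod M) \<rho> \<and> inj_on \<rho> (carrier (A Mod N))"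
proof -
  interpret f: group_hom A B f by fact
  interpret N: normal N A by fact
  interpret M: normal M B by fact
  define h where "h = (\<lambda>x. M #>\<^bsub>B\<^esub> f x)"
  have "h \<in> hom A (B Mod M)"
    using Group.hom_compose[OF f.homh M.r_coset_hom_Mod] by (simp add: h_def comp_def)
  then interpret h: group_hom A "B Mod M" h
    by (intro group_hom.intro group_hom_axioms.intro f.G.group_axioms M.factorgroup_is_group)
  have ker: "kernel A (B Mod M) h = N"
  proof -
    have "h x = M \<longleftrightarrow> x \<in> N" if "x \<in> carrier A" for x
      using that iff[OF that] f.H.coset_join1[OF _ _ M.subgroup_axioms]
        f.H.coset_join2[OF _ M.subgroup_axioms] f.hom_closed
      unfolding h_def by blast
    then show ?thesis
      using N.subset by (auto simp: kernel_def FactGroup_def)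
  qed
  \<comment> \<open>\<open>h\<close> is constant on each coset of its kernel, so the image of a
    coset is a singleton and \<open>the_elem\<close> returns its value.\<close>
  let ?\<rho> = "\<lambda>X. the_elem (h ` X)"
  have "?\<rho> (N #>\<^bsub>A\<^esub> x) = M #>\<^bsub>B\<^esub> f x" if x: "x \<in> carrier A" for x
  proof -
    have "h (y \<otimes>\<^bsub>A\<^esub> x) = h x" if "y \<in> kernel A (B Mod M) h" for y
    proof -
      have y: "y \<in> carrier A" "h y = \<one>\<^bsub>B Mod M\<^esub>"
        using that by (simp_all only: kernel_def mem_Collect_eq)
      show ?thesis
        by (simp only: h.hom_mult[OF y(1) x] y(2) h.H.l_one[OF h.hom_closed[OF x]])
    qed
    then have "\<forall>y\<in>N #>\<^bsub>A\<^esub> x. h y = h x"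
      unfolding ker r_coset_def by blast
    moreover have "x \<in> N #>\<^bsub>A\<^esub> x"
      using x by (rule f.G.rcos_self) (rule N.subgroup_axioms)
    ultimately have "h ` (N #>\<^bsub>A\<^esub> x) = {h x}" by blast
    then show ?thesis by (simp add: h_def)
  qed
  moreover have "group_hom (A Mod N) (B Mod M) ?\<rho>"
    using h.FactGroup_hom unfolding ker
    by (intro group_hom.intro group_hom_axioms.intro N.factorgroup_is_group
        M.factorgroup_is_group)
  moreover have "inj_on ?\<rho> (carrier (A Mod N))"
    using h.FactGroup_inj_on unfolding ker .
  ultimately show ?thesis by (intro exI[of _ ?\<rho>]) simp
qed

section \<open>Integer vectors, matrices and the Laplacian\<close>

lemma carrier_int_vectors: "carrier (int_vectors I) = (\<Pi>\<^sub>E i\<in>I. UNIV)"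
  by (simp add: int_vectors_def)

lemma mult_int_vectors: "x \<otimes>\<^bsub>int_vectors I\<^esub> y = (\<lambda>i\<in>I. x i + y i)"
  by (simp add: int_vectors_def)

lemma comm_group_int_vectors: "comm_group (int_vectors I)"
proof (rule group.group_comm_groupI)
  show "group (int_vectors I)" by (simp add: int_vectors_def)
qed (simp add: mult_int_vectors add.commute)

lemma mat_vec_group_hom: "group_hom (int_vectors J) (int_vectors I) (mat_vec I J M)"
proof (intro group_hom.intro group_hom_axioms.intro homI)
  fix x y
  show "mat_vec I J M (x \<otimes>\<^bsub>int_vectors J\<^esub> y) =
      mat_vec I J M x \<otimes>\<^bsub>int_vectors I\<^esub> mat_vec I J M y"
    by (auto simp: mult_int_vectors mat_vec_def algebra_simps simp flip: sum.distrib
        intro!: restrict_ext sum.cong)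
qed (auto simp: comm_group_int_vectors comm_group.axioms carrier_int_vectors mat_vec_def)

lemma laplacian_image_normal: "laplacian_image G \<lhd> int_vectors (verts G)"
  unfolding laplacian_image_def
  by (rule comm_group.subgroup_imp_normal[OF comm_group_int_vectors])
    (rule group_hom.img_is_subgroup[OF mat_vec_group_hom])

text \<open>The diagonal entry is the row sum of the adjacency matrix, so it can be distributed over
  the outgoing arcs. In this difference form loops cancel and constant vectors visibly lie in the
  kernel.\<close>

lemma mat_vec_laplacian:
  assumes "finite (verts G)" "v \<in> verts G"
  shows "mat_vec (verts G) (verts G) (laplacian G) z v =
    (\<Sum>w\<in>verts G. adjacency_matrix G v w * (z v - z w))"
proof -
  have "(\<Sum>w\<in>verts G. degree_matrix G v w * z w) =
      (\<Sum>w\<in>verts G. if v = w then (\<Sum>u\<in>verts G. adjacency_matrix G v u) * z w else 0)"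
    by (rule sum.cong) (auto simp: degree_matrix_def)
  also have "\<dots> = (\<Sum>w\<in>verts G. adjacency_matrix G v w * z v)"
    using assms by (simp add: sum_distrib_right)
  finally show ?thesis
    using assms by (simp add: mat_vec_def laplacian_def algebra_simps sum_subtractf)
qed

text \<open>Maximum principle: maximality passes from a vertex to its out-neighbours, and strong
  connectivity carries it to every vertex. The values are real because block averages need not be
  integers.\<close>

lemma harmonic_imp_constant:
  fixes u :: "'a \<Rightarrow> real"
  assumes "fin_digraph G" "strongly_connected G"
    and harmonic: "\<And>v. v \<in> verts G \<Longrightarrow>
      (\<Sum>w\<in>verts G. of_int (adjacency_matrix G v w) * (u v - u w)) = 0"
  obtains c where "\<And>v. v \<in> verts G \<Longrightarrow> u v = c"
proof -
  interpret fin_digraph G by fact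
  define c where "c = Max (u ` verts G)"
  have le: "u w \<le> c" if "w \<in> verts G" for w
    using that by (simp add: c_def)
  \<comment> \<open>Strong connectivity includes nonemptiness of the vertex set, so the maximum is
    attained.\<close>
  have "c \<in> u ` verts G"
    unfolding c_def using assms(2) by (intro Max_in) (auto simp: strongly_connected_def)
  then obtain v0 where v0: "v0 \<in> verts G" "u v0 = c" by blast
  have step: "u w = c" if vw: "v \<rightarrow>\<^bsub>G\<^esub> w" and v: "u v = c" for v w
  proof -
    have verts: "v \<in> verts G" "w \<in> verts G" using vw by auto
    obtain e where "e \<in> arcs G" "tail G e = v" "head G e = w" using vw by auto
    then have "adjacency_matrix G v w > 0"
      by (auto simp: adjacency_matrix_def card_gt_0_iff)
    \<comment> \<open>At a maximum all summands are nonnegative; as they sum to zero, each one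
      vanishes.\<close>
    moreover have "of_int (adjacency_matrix G v w) * (u v - u w) = 0"
      using verts v le harmonic[OF verts(1)]
      by (subst (asm) sum_nonneg_eq_0_iff) (auto simp: adjacency_matrix_def)
    ultimately show ?thesis using v by auto
  qed
  have "u v = c" if "v \<in> verts G" for v
  proof -
    have "v0 \<rightarrow>\<^sup>*\<^bsub>G\<^esub> v" using assms(2) v0 that by auto
    then show ?thesis
      by (induction rule: reachable_induct) (use v0 step in auto)
  qed
  then show thesis by (rule that)
qed

section \<open>Counting arcs between the blocks of an equitable partition\<close>

lemma sum_adjacency_matrix_row:
  assumes "finite (arcs G)" "finite S"
  shows "(\<Sum>w\<in>S. adjacency_matrix G v w) = int (card {e \<in> arcs G. tail G e = v \<and> head G e \<in> S})"
proof -
  have "{e \<in> arcs G. tail G e = v \<and> head G e \<in> S} =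
      (\<Union>w\<in>S. {e \<in> arcs G. tail G e = v \<and> head G e = w})" by auto
  then show ?thesis
    using assms by (simp only: adjacency_matrix_def) (subst card_UN_disjoint, auto)
qed

lemma sum_adjacency_matrix_column:
  assumes "finite (arcs G)" "finite S"
  shows "(\<Sum>v\<in>S. adjacency_matrix G v w) = int (card {e \<in> arcs G. head G e = w \<and> tail G e \<in> S})"
proof -
  have "{e \<in> arcs G. head G e = w \<and> tail G e \<in> S} =
      (\<Union>v\<in>S. {e \<in> arcs G. tail G e = v \<and> head G e = w})" by auto
  then show ?thesis
    using assms by (simp only: adjacency_matrix_def) (subst card_UN_disjoint, auto)
qed

locale equitable_digraph = fin_digraph G for G :: "('a, 'b) pre_digraph" +
  fixes p :: nat and \<pi> :: "nat \<Rightarrow> 'a set" and F R :: "nat \<Rightarrow> nat \<Rightarrow> nat"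
  assumes part: "ordered_partition (verts G) p \<pi>"
    and equitable: "equitable_with G p \<pi> F R"
begin

abbreviation adj :: "'a \<Rightarrow> 'a \<Rightarrow> int" where "adj \<equiv> adjacency_matrix G"

lemma block_subset: "i \<in> {1..p} \<Longrightarrow> \<pi> i \<subseteq> verts G"
  using part by (auto simp: ordered_partition_def)

lemma finite_block: "i \<in> {1..p} \<Longrightarrow> finite (\<pi> i)"
  using block_subset finite_verts by (blast intro: finite_subset)

lemma block_nonempty: "i \<in> {1..p} \<Longrightarrow> \<pi> i \<noteq> {}"
  using part by (auto simp: ordered_partition_def)

lemma block_unique: "\<lbrakk>i \<in> {1..p}; j \<in> {1..p}; v \<in> \<pi> i; v \<in> \<pi> j\<rbrakk> \<Longrightarrow> i = j"
  using part unfolding ordered_partition_def disjoint_family_on_def by blast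

lemma block_exists:
  assumes "v \<in> verts G"
  obtains i where "i \<in> {1..p}" "v \<in> \<pi> i"
  using part assms unfolding ordered_partition_def by blast

lemma sum_verts_blocks: "(\<Sum>w\<in>verts G. f w) = (\<Sum>j\<in>{1..p}. \<Sum>w\<in>\<pi> j. f w)"
proof -
  have "(\<Sum>w\<in>(\<Union>j\<in>{1..p}. \<pi> j). f w) = (\<Sum>j\<in>{1..p}. \<Sum>w\<in>\<pi> j. f w)"
    by (rule sum.UNION_disjoint) (use finite_block block_unique in auto)
  then show ?thesis using part by (simp add: ordered_partition_def)
qed

lemma row_sum:
  "\<lbrakk>i \<in> {1..p}; j \<in> {1..p}; v \<in> \<pi> i\<rbrakk> \<Longrightarrow> (\<Sum>w\<in>\<pi> j. adj v w) = int (F i j)"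
  using equitable by (subst sum_adjacency_matrix_row) (auto simp: finite_block equitable_with_def)

lemma column_sum:
  "\<lbrakk>i \<in> {1..p}; j \<in> {1..p}; w \<in> \<pi> j\<rbrakk> \<Longrightarrow> (\<Sum>v\<in>\<pi> i. adj v w) = int (R i j)"
  using equitable by (subst sum_adjacency_matrix_column) (auto simp: finite_block equitable_with_def)

text \<open>Double counting of the arcs from block \<open>i\<close> to block \<open>j\<close>, once
  by tail and once by head.\<close>

lemma card_block_balance:
  assumes "i \<in> {1..p}" "j \<in> {1..p}"
  shows "int (card (\<pi> i)) * int (F i j) = int (card (\<pi> j)) * int (R i j)"
proof -
  have "(\<Sum>v\<in>\<pi> i. \<Sum>w\<in>\<pi> j. adj v w) = (\<Sum>w\<in>\<pi> j. \<Sum>v\<in>\<pi> i. adj v w)"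
    by (rule sum.swap)
  then show ?thesis using assms by (simp add: row_sum column_sum)
qed

lemma sum_adj_blockwise:
  fixes c :: "nat \<Rightarrow> real"
  assumes "i \<in> {1..p}" "v \<in> \<pi> i" and g: "\<And>j w. \<lbrakk>j \<in> {1..p}; w \<in> \<pi> j\<rbrakk> \<Longrightarrow> g w = c j"
  shows "(\<Sum>w\<in>verts G. of_int (adj v w) * g w) = (\<Sum>j\<in>{1..p}. of_nat (F i j) * c j)"
  unfolding sum_verts_blocks
proof (rule sum.cong[OF refl])
  fix j assume j: "j \<in> {1..p}"
  have "(\<Sum>w\<in>\<pi> j. of_int (adj v w) * g w) = of_int (\<Sum>w\<in>\<pi> j. adj v w) * c j"
    using g[OF j] by (simp add: sum_distrib_right)
  then show "(\<Sum>w\<in>\<pi> j. of_int (adj v w) * g w) = of_nat (F i j) * c j"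
    using row_sum[OF assms(1) j assms(2)] by simp
qed

text \<open>The core of injectivity. Averaging over blocks by itself yields only a real solution of
  the quotient equation; constancy of \<open>z\<close> on blocks is what provides an integral
  one.\<close>

lemma laplacian_blockwise_imp_blockwise:
  fixes z :: "'a \<Rightarrow> int" and x :: "nat \<Rightarrow> int"
  assumes "strongly_connected G"
    and lap: "\<And>i v. \<lbrakk>i \<in> {1..p}; v \<in> \<pi> i\<rbrakk> \<Longrightarrow> (\<Sum>w\<in>verts G. adj v w * (z v - z w)) = x i"
    and i: "i \<in> {1..p}" "v \<in> \<pi> i" "v' \<in> \<pi> i"
  shows "z v = z v'"
proof -
  define n where "n i = real (card (\<pi> i))" for i
  define y where "y i = (\<Sum>v\<in>\<pi> i. real_of_int (z v)) / n i" for i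
  \<comment> \<open>The block index of a vertex, unique because blocks are disjoint; it serves to
    pull \<open>y\<close> back to the vertices.\<close>
  define b where "b v = (THE i. i \<in> {1..p} \<and> v \<in> \<pi> i)" for v
  have b: "b v = i" if "i \<in> {1..p}" "v \<in> \<pi> i" for i v
    unfolding b_def using that block_unique by blast
  have n_pos: "n i > 0" if "i \<in> {1..p}" for i
    using that finite_block block_nonempty by (simp add: n_def card_gt_0_iff)
  have sum_z: "(\<Sum>v\<in>\<pi> i. real_of_int (z v)) = n i * y i" if "i \<in> {1..p}" for i
    using n_pos[OF that] by (simp add: y_def)
  have balance: "n i * F i j = n j * R i j" if "i \<in> {1..p}" "j \<in> {1..p}" for i j
    using arg_cong[OF card_block_balance[OF that], of real_of_int] by (simp add: n_def)
  have lap_real: "(\<Sum>w\<in>verts G. of_int (adj v w) * (real_of_int (z v) - z w)) = x i"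
    if "i \<in> {1..p}" "v \<in> \<pi> i" for i v
    using arg_cong[OF lap[OF that], of real_of_int] by simp
  have avg: "(\<Sum>j\<in>{1..p}. F i j * (y i - y j)) = x i" if i: "i \<in> {1..p}" for i
  proof -
    \<comment> \<open>The \<open>z v\<close> part of the difference collects row sums; the
      \<open>z w\<close> part, after exchanging the sums, collects column sums.\<close>
    have block: "(\<Sum>v\<in>\<pi> i. \<Sum>w\<in>\<pi> j. of_int (adj v w) * (real_of_int (z v) - z w)) =
        n i * (F i j * (y i - y j))" if j: "j \<in> {1..p}" for j
    proof -
      have "(\<Sum>v\<in>\<pi> i. \<Sum>w\<in>\<pi> j. of_int (adj v w) * (real_of_int (z v) - z w)) =
          (\<Sum>v\<in>\<pi> i. of_int (\<Sum>w\<in>\<pi> j. adj v w) * real_of_int (z v)) -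
          (\<Sum>w\<in>\<pi> j. of_int (\<Sum>v\<in>\<pi> i. adj v w) * real_of_int (z w))"
        by (simp add: right_diff_distrib sum_subtractf sum_distrib_right sum.swap[of _ "\<pi> j" "\<pi> i"])
      also have "\<dots> = F i j * (\<Sum>v\<in>\<pi> i. real_of_int (z v)) - R i j * (\<Sum>w\<in>\<pi> j. real_of_int (z w))"
        using i j by (simp only: row_sum column_sum sum_distrib_left cong: sum.cong) simp
      \<comment> \<open>Balance replaces \<open>n j * R i j\<close> by \<open>n i * F i j\<close>,
        so only the quotient matrix remains and the common factor \<open>n i\<close> can later be
        cancelled.\<close>
      also have "\<dots> = n i * (F i j * (y i - y j))"
        using balance[OF i j] by (simp only: sum_z i j) (simp add: algebra_simps)
      finally show ?thesis .
    qed
    have "n i * x i = (\<Sum>v\<in>\<pi> i. \<Sum>w\<in>verts G. of_int (adj v w) * (real_of_int (z v) - z w))"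
      using lap_real[OF i] by (simp add: n_def)
    also have "\<dots> = (\<Sum>j\<in>{1..p}. \<Sum>v\<in>\<pi> i. \<Sum>w\<in>\<pi> j. of_int (adj v w) * (real_of_int (z v) - z w))"
      unfolding sum_verts_blocks by (rule sum.swap)
    also have "\<dots> = n i * (\<Sum>j\<in>{1..p}. F i j * (y i - y j))"
      by (simp add: block sum_distrib_left)
    finally show ?thesis using n_pos[OF i] by simp
  qed
  \<comment> \<open>The Laplacian sends both \<open>z\<close> and the pulled-back averages to the
    value \<open>x i\<close> on block \<open>i\<close>, so their difference is harmonic.\<close>
  define u where "u v = real_of_int (z v) - y (b v)" for v
  have "(\<Sum>w\<in>verts G. of_int (adj v w) * (u v - u w)) = 0" if "v \<in> verts G" for v
  proof -
    obtain i where i: "i \<in> {1..p}" "v \<in> \<pi> i" using block_exists[OF \<open>v \<in> verts G\<close>] .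
    have "(\<Sum>w\<in>verts G. of_int (adj v w) * (u v - u w)) =
        (\<Sum>w\<in>verts G. of_int (adj v w) * (real_of_int (z v) - z w)) -
        (\<Sum>w\<in>verts G. of_int (adj v w) * (y (b v) - y (b w)))"
      by (simp add: u_def algebra_simps flip: sum_subtractf sum.distrib)
    moreover have "(\<Sum>w\<in>verts G. of_int (adj v w) * (y (b v) - y (b w))) = x i"
      using sum_adj_blockwise[OF i, of "\<lambda>w. y (b v) - y (b w)" "\<lambda>j. y i - y j"] avg i b by simp
    ultimately show ?thesis using lap_real[OF i] by simp
  qed
  then obtain c where "\<And>v. v \<in> verts G \<Longrightarrow> u v = c"
    using harmonic_imp_constant[OF fin_digraph_axioms assms(1)] by blast
  then have "u v = u v'" using i block_subset by blast
  then show ?thesis using i b by (simp add: u_def)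
qed

section \<open>The partition matrix and the Laplacian of the quotient\<close>

lemma mat_vec_partition_matrix:
  assumes "i \<in> {1..p}" "v \<in> \<pi> i"
  shows "mat_vec (verts G) {1..p} (partition_matrix \<pi>) x v = x i"
proof -
  have "(\<Sum>j\<in>{1..p}. partition_matrix \<pi> v j * x j) = (\<Sum>j\<in>{1..p}. if j = i then x j else 0)"
    using assms block_unique by (intro sum.cong) (auto simp: partition_matrix_def)
  then show ?thesis using assms block_subset by (auto simp: mat_vec_def)
qed

lemma quotient_matrix_F:
  "\<lbrakk>i \<in> {1..p}; j \<in> {1..p}\<rbrakk> \<Longrightarrow> quotient_matrix G p \<pi> i j = F i j"
  using quotient_matrix_eq part equitable unfolding equitable_partition_def by blast

lemma mat_vec_laplacian_quotient:
  assumes "i \<in> {1..p}"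
  shows "mat_vec {1..p} {1..p} (laplacian (quotient_graph G p \<pi>)) y i =
    (\<Sum>j\<in>{1..p}. int (F i j) * (y i - y j))"
proof -
  have V: "verts (quotient_graph G p \<pi>) = {1..p}" by (simp add: quotient_graph_def)
  show ?thesis
    using mat_vec_laplacian[of "quotient_graph G p \<pi>" i y] assms unfolding V
    by (simp add: adjacency_matrix_quotient_graph quotient_matrix_F)
qed

text \<open>A vector in the image of the partition matrix is constant on blocks, so its differences
  leave the inner sums and the remaining row sums are the entries \<open>F i j\<close>. Off the
  vertex set both sides are \<open>undefined\<close>.\<close>

lemma laplacian_partition_matrix_commute:
  "mat_vec (verts G) (verts G) (laplacian G) (mat_vec (verts G) {1..p} (partition_matrix \<pi>) y) =
   mat_vec (verts G) {1..p} (partition_matrix \<pi>)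
     (mat_vec {1..p} {1..p} (laplacian (quotient_graph G p \<pi>)) y)"
    (is "?L = ?R")
proof
  fix v
  show "?L v = ?R v"
  proof (cases "v \<in> verts G")
    case True
    then obtain i where i: "i \<in> {1..p}" "v \<in> \<pi> i" using block_exists by blast
    let ?Py = "mat_vec (verts G) {1..p} (partition_matrix \<pi>) y"
    have "?L v = (\<Sum>j\<in>{1..p}. \<Sum>w\<in>\<pi> j. adj v w * (?Py v - ?Py w))"
      using True by (simp add: mat_vec_laplacian sum_verts_blocks)
    also have "\<dots> = (\<Sum>j\<in>{1..p}. (\<Sum>w\<in>\<pi> j. adj v w) * (y i - y j))"
      using i by (simp add: mat_vec_partition_matrix sum_distrib_right del: One_nat_def)
    also have "\<dots> = (\<Sum>j\<in>{1..p}. int (F i j) * (y i - y j))"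
      using i by (simp add: row_sum)
    also have "\<dots> = ?R v"
      using i by (simp add: mat_vec_partition_matrix mat_vec_laplacian_quotient del: One_nat_def)
    finally show ?thesis .
  qed (simp add: mat_vec_def)
qed

text \<open>This supplies the premise \<open>iff\<close> of \<open>induced_hom_on_quotients\<close>
  for the partition matrix.\<close>

lemma partition_matrix_in_laplacian_image_iff:
  assumes "strongly_connected G" and x: "x \<in> carrier (int_vectors {1..p})"
  shows "mat_vec (verts G) {1..p} (partition_matrix \<pi>) x \<in> laplacian_image G \<longleftrightarrow>
    x \<in> laplacian_image (quotient_graph G p \<pi>)"
    (is "?P x \<in> _ \<longleftrightarrow> _")
proof
  let ?Q = "mat_vec (verts G) (verts G) (laplacian G)"
  let ?Q' = "mat_vec {1..p} {1..p} (laplacian (quotient_graph G p \<pi>))"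
  have image: "laplacian_image (quotient_graph G p \<pi>) = ?Q' ` carrier (int_vectors {1..p})"
    by (simp add: laplacian_image_def quotient_graph_def)
  have P_carrier: "?P y \<in> carrier (int_vectors (verts G))" for y
    by (auto simp: carrier_int_vectors mat_vec_def)
  {
    assume "x \<in> laplacian_image (quotient_graph G p \<pi>)"
    then obtain y where "x = ?Q' y" unfolding image by blast
    then have "?P x = ?Q (?P y)" by (simp only: laplacian_partition_matrix_commute)
    then show "?P x \<in> laplacian_image G"
      using P_carrier unfolding laplacian_image_def by blast
  }
  assume "?P x \<in> laplacian_image G"
  then obtain z where z: "z \<in> carrier (int_vectors (verts G))" "?P x = ?Q z"
    unfolding laplacian_image_def by blast
  have "(\<Sum>w\<in>verts G. adj v w * (z v - z w)) = x i" if "i \<in> {1..p}" "v \<in> \<pi> i" for i v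
  proof -
    have "v \<in> verts G" using that block_subset by blast
    then show ?thesis
      using mat_vec_partition_matrix[OF that, of x] z(2) mat_vec_laplacian[of G v z] by simp
  qed
  note const = laplacian_blockwise_imp_blockwise[of z x, OF assms(1) this]
  \<comment> \<open>Any representative of a block gives the same value of \<open>z\<close>; the
    restriction puts \<open>y\<close> into the carrier.\<close>
  define y where "y = (\<lambda>i\<in>{1..p}. z (SOME v. v \<in> \<pi> i))"
  have y: "z v = y i" if "i \<in> {1..p}" "v \<in> \<pi> i" for i v
    using const[OF _ _ that someI[of "\<lambda>v. v \<in> \<pi> i" v]] that by (simp add: y_def)
  have "z = ?P y"
  proof
    fix v
    show "z v = ?P y v"
    proof (cases "v \<in> verts G")
      case True
      then obtain i where "i \<in> {1..p}" "v \<in> \<pi> i" using block_exists by blast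
      then show ?thesis by (simp add: mat_vec_partition_matrix y del: One_nat_def)
    next
      case False
      then show ?thesis using z(1) by (auto simp: carrier_int_vectors mat_vec_def PiE_iff extensional_def)
    qed
  qed
  then have PP: "?P x = ?P (?Q' y)"
    using z(2) by (simp only: laplacian_partition_matrix_commute)
  \<comment> \<open>The partition matrix is injective on vectors over \<open>{1..p}\<close>: each
    block is nonempty, and evaluating \<open>PP\<close> at one of its vertices recovers the
    coordinate.\<close>
  have "x = ?Q' y"
  proof
    fix i
    show "x i = ?Q' y i"
    proof (cases "i \<in> {1..p}")
      case True
      then obtain v where "v \<in> \<pi> i" using block_nonempty by blast
      with True PP show ?thesis by (metis mat_vec_partition_matrix)
    next
      case False
      then show ?thesis using x by (auto simp: carrier_int_vectors mat_vec_def PiE_iff extensional_def)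
    qed
  qed
  moreover have "y \<in> carrier (int_vectors {1..p})"
    by (simp add: carrier_int_vectors y_def)
  ultimately show "x \<in> laplacian_image (quotient_graph G p \<pi>)"
    unfolding image by blast
qed

end

theorem theorem6p1:
  fixes G :: "('a, 'b) pre_digraph" and p :: nat and \<pi> :: "nat \<Rightarrow> 'a set"
  assumes "fin_digraph G"
    and "strongly_connected G"
    and "equitable_partition G p \<pi>"
  shows "\<exists>\<rho>.
    (\<forall>x \<in> carrier (int_vectors {1..p}).
       \<rho> (laplacian_image (quotient_graph G p \<pi>) #>\<^bsub>int_vectors {1..p}\<^esub> x)
       = laplacian_image G #>\<^bsub>int_vectors (verts G)\<^esub>
           mat_vec (verts G) {1..p} (partition_matrix \<pi>) x) \<and>
    group_hom (dual_critical_group (quotient_graph G p \<pi>)) (dual_critical_group G) \<rho> \<and>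
    inj_on \<rho> (carrier (dual_critical_group (quotient_graph G p \<pi>)))"
proof -
  obtain F R where "ordered_partition (verts G) p \<pi>" "equitable_with G p \<pi> F R"
    using assms(3) unfolding equitable_partition_def by blast
  then interpret equitable_digraph G p \<pi> F R
    using assms(1) by (intro equitable_digraph.intro equitable_digraph_axioms.intro)
  \<comment> \<open>This identifies the index set of the quotient's group with
    \<open>{1..p}\<close>, the domain of the partition matrix.\<close>
  have V: "verts (quotient_graph G p \<pi>) = {1..p}" by (simp add: quotient_graph_def)
  show ?thesis
    unfolding dual_critical_group_def V
    by (rule induced_hom_on_quotients[OF mat_vec_group_hom _ laplacian_image_normal])
      (use laplacian_image_normal[of "quotient_graph G p \<pi>"]
        partition_matrix_in_laplacian_image_iff[OF assms(2)] in \<open>auto simp: V\<close>)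
qed

end
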